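(* Let $G$ be a finite group such that $G/Z(G)\cong Sz(2)$, where $Sz(2)=\langle a,b : a^5=b^4=1,\ b^{-1}ab=a^2\rangle$. Then $$\operatorname{Spec}(\Gamma_G) = \left\{(-1)^{19|Z(G)|-6},\ (4|Z(G)|-1)^1,\ (3|Z(G)|-1)^5\right\}.$$
   Context: For a finite non-abelian group $G$ with centre $Z(G)$, the commuting graph $\Gamma_G$ is the simple undirected graph with vertex set $G\setminus Z(G)$ in which two distinct vertices $x,y$ are adjacent if and only if $xy=yx$. The spectrum $\operatorname{Spec}$ of a graph is the multiset of eigenvalues of its adjacency matrix, written $\{\lambda_1^{k_1},\dots,\lambda_r^{k_r}\}$, where $\lambda^{k}$ denotes that $\lambda$ is listed $k$ times (listed values may coincide, in which case multiplicities add). *)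

theory Defs
  imports
    "HOL-Computational_Algebra.Fundamental_Theorem_Algebra"
    "HOL-Algebra.Coset"
    "Graph_Theory.Pair_Digraph"
    "Jordan_Normal_Form.Char_Poly"
begin

text \<open>
  A word over the generators is a list of signed letters: \<open>(x, True)\<close> stands for \<open>x\<close> and
  \<open>(x, False)\<close> for the formal inverse of \<open>x\<close>. The generators are all elements of the
  type \<open>'g\<close>; a pair \<open>(l, r)\<close> in \<open>R\<close> is the relation \<open>l = r\<close>.
\<close>

type_synonym 'g word = "('g \<times> bool) list"

definition word_gen :: "'g \<Rightarrow> 'g word" where
  "word_gen x = [(x, True)]"

definition word_inv :: "'g word \<Rightarrow> 'g word" where
  "word_inv w = rev (map (\<lambda>(x, s). (x, \<not> s)) w)"

definition word_pow :: "'g word \<Rightarrow> nat \<Rightarrow> 'g word" where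
  "word_pow w n = concat (replicate n w)"

inductive word_eq :: "('g word \<times> 'g word) set \<Rightarrow> 'g word \<Rightarrow> 'g word \<Rightarrow> bool"
  for R :: "('g word \<times> 'g word) set" where
  refl: "word_eq R w w"
| sym: "word_eq R v w \<Longrightarrow> word_eq R w v"
| trans: "word_eq R u v \<Longrightarrow> word_eq R v w \<Longrightarrow> word_eq R u w"
| cancel: "word_eq R (u @ [(x, s), (x, \<not> s)] @ v) (u @ v)"
| relation: "(l, r) \<in> R \<Longrightarrow> word_eq R (u @ l @ v) (u @ r @ v)"

definition word_rel :: "('g word \<times> 'g word) set \<Rightarrow> ('g word \<times> 'g word) set" where
  "word_rel R = {(v, w). word_eq R v w}"

definition presented_group :: "('g word \<times> 'g word) set \<Rightarrow> 'g word set monoid" where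
  "presented_group R =
    \<lparr>carrier = UNIV // word_rel R,
     monoid.mult = (\<lambda>A B. \<Union>v\<in>A. \<Union>w\<in>B. word_rel R `` {v @ w}),
     one = word_rel R `` {[]}\<rparr>"

lemma equiv_word_rel: "equiv UNIV (word_rel R)"
proof (rule equivI)
  show "refl_on UNIV (word_rel R)"
    by (auto simp: word_rel_def refl_on_def intro: word_eq.refl)
  show "sym_on UNIV (word_rel R)"
    by (auto simp: word_rel_def sym_on_def intro: word_eq.sym)
  show "trans_on UNIV (word_rel R)"
    unfolding word_rel_def trans_on_def by (blast intro: word_eq.trans)
qed auto

lemma word_eq_append_left: "word_eq R v w \<Longrightarrow> word_eq R (u @ v) (u @ w)"
proof (induction rule: word_eq.induct)
  case (cancel a x s b)
  show ?case using word_eq.cancel[of R "u @ a" x s b] by simp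
next
  case (relation l r a b)
  then show ?case using word_eq.relation[of l r R "u @ a" b] by simp
qed (auto intro: word_eq.refl word_eq.sym elim: word_eq.trans)

lemma word_eq_append_right: "word_eq R v w \<Longrightarrow> word_eq R (v @ u) (w @ u)"
proof (induction rule: word_eq.induct)
  case (cancel a x s b)
  show ?case using word_eq.cancel[of R a x s "b @ u"] by simp
next
  case (relation l r a b)
  then show ?case using word_eq.relation[of l r R a "b @ u"] by simp
qed (auto intro: word_eq.refl word_eq.sym elim: word_eq.trans)

lemma word_eq_append:
  "word_eq R v v' \<Longrightarrow> word_eq R w w' \<Longrightarrow> word_eq R (v @ w) (v' @ w')"
  by (meson word_eq.trans word_eq_append_left word_eq_append_right)

lemma word_eq_inv_left: "word_eq R (word_inv w @ w) []"
proof (induction w)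
  case Nil
  show ?case by (simp add: word_inv_def word_eq.refl)
next
  case (Cons y w)
  obtain x s where y: "y = (x, s)" by force
  have "word_eq R (word_inv w @ [(x, \<not> s), (x, \<not> \<not> s)] @ w) (word_inv w @ w)"
    by (rule word_eq.cancel)
  then have "word_eq R (word_inv w @ [(x, \<not> s), (x, \<not> \<not> s)] @ w) []"
    using Cons.IH by (rule word_eq.trans)
  then show ?case by (simp add: y word_inv_def)
qed

lemma presented_group_mult:
  "word_rel R `` {v} \<otimes>\<^bsub>presented_group R\<^esub> word_rel R `` {w} = word_rel R `` {v @ w}"
proof -
  have "congruent2 (word_rel R) (word_rel R) (\<lambda>v w. word_rel R `` {v @ w})"
    by (rule congruent2I', rule equiv_class_eq[OF equiv_word_rel])
       (simp add: word_rel_def word_eq_append)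
  from UN_equiv_class2[OF equiv_word_rel equiv_word_rel this, of v w]
  show ?thesis by (simp add: presented_group_def)
qed

lemma group_presented_group: "group (presented_group R)"
proof (rule groupI)
  fix A B assume "A \<in> carrier (presented_group R)" "B \<in> carrier (presented_group R)"
  then obtain v w where "A = word_rel R `` {v}" "B = word_rel R `` {w}"
    by (auto simp: presented_group_def elim!: quotientE)
  then show "A \<otimes>\<^bsub>presented_group R\<^esub> B \<in> carrier (presented_group R)"
    by (simp add: presented_group_mult) (simp add: presented_group_def quotientI)
next
  show "\<one>\<^bsub>presented_group R\<^esub> \<in> carrier (presented_group R)"
    by (simp add: presented_group_def quotientI)
next
  fix A B C
  assume "A \<in> carrier (presented_group R)" "B \<in> carrier (presented_group R)"
    "C \<in> carrier (presented_group R)"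
  then obtain u v w where
    "A = word_rel R `` {u}" "B = word_rel R `` {v}" "C = word_rel R `` {w}"
    by (auto simp: presented_group_def elim!: quotientE)
  then show "A \<otimes>\<^bsub>presented_group R\<^esub> B \<otimes>\<^bsub>presented_group R\<^esub> C =
      A \<otimes>\<^bsub>presented_group R\<^esub> (B \<otimes>\<^bsub>presented_group R\<^esub> C)"
    by (simp add: presented_group_mult)
next
  fix A assume "A \<in> carrier (presented_group R)"
  then obtain w where A: "A = word_rel R `` {w}"
    by (auto simp: presented_group_def elim!: quotientE)
  have one: "\<one>\<^bsub>presented_group R\<^esub> = word_rel R `` {[]}"
    by (simp add: presented_group_def)
  show "\<one>\<^bsub>presented_group R\<^esub> \<otimes>\<^bsub>presented_group R\<^esub> A = A"
    by (simp add: A one presented_group_mult)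
  have "word_rel R `` {word_inv w @ w} = word_rel R `` {[]}"
    by (rule equiv_class_eq[OF equiv_word_rel]) (simp add: word_rel_def word_eq_inv_left)
  moreover have "word_rel R `` {word_inv w} \<in> carrier (presented_group R)"
    by (simp add: presented_group_def quotientI)
  ultimately show "\<exists>B\<in>carrier (presented_group R). B \<otimes>\<^bsub>presented_group R\<^esub> A = \<one>\<^bsub>presented_group R\<^esub>"
    by (metis A one presented_group_mult)
qed

datatype sz2_gen = Sz2_a | Sz2_b

definition Sz2 :: "sz2_gen word set monoid" where
  "Sz2 = (let a = word_gen Sz2_a; b = word_gen Sz2_b in
    presented_group
      {(word_pow a 5, []),
       (word_pow b 4, []),
       (word_inv b @ a @ b, word_pow a 2)})"

definition center :: "('a, 'b) monoid_scheme \<Rightarrow> 'a set" where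
  "center G = {z \<in> carrier G. \<forall>x\<in>carrier G. z \<otimes>\<^bsub>G\<^esub> x = x \<otimes>\<^bsub>G\<^esub> z}"

text \<open>
  An undirected graph is a symmetric digraph: each edge is represented by the two arcs joining
  its end points, see \<open>pair_graph_commuting_graph\<close>.
\<close>

definition commuting_graph :: "('a, 'b) monoid_scheme \<Rightarrow> 'a pair_pre_digraph" where
  "commuting_graph G =
    \<lparr>pverts = carrier G - center G,
     parcs = {(x, y). x \<in> carrier G - center G \<and> y \<in> carrier G - center G \<and>
                      x \<noteq> y \<and> x \<otimes>\<^bsub>G\<^esub> y = y \<otimes>\<^bsub>G\<^esub> x}\<rparr>"

lemma pair_graph_commuting_graph:
  assumes "finite (carrier G)"
  shows "pair_graph (commuting_graph G)"
proof
  show "finite (parcs (commuting_graph G))"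
    by (rule finite_subset[of _ "carrier G \<times> carrier G"])
       (auto simp: commuting_graph_def assms)
  show "symmetric (with_proj (commuting_graph G))"
    by (auto simp: commuting_graph_def symmetric_def arcs_ends_def arc_to_ends_def sym_def)
qed (auto simp: commuting_graph_def assms)

definition adjacency_matrix :: "'a pair_pre_digraph \<Rightarrow> 'a list \<Rightarrow> complex mat" where
  "adjacency_matrix \<Gamma> vs =
    mat (length vs) (length vs) (\<lambda>(i, j). if (vs ! i, vs ! j) \<in> parcs \<Gamma> then 1 else 0)"

text \<open>
  The multiplicity of an eigenvalue is its multiplicity as a root of the characteristic
  polynomial. The enumeration of the vertices is irrelevant by \<open>graph_spectrum_eq\<close>.
\<close>

definition graph_spectrum :: "'a pair_pre_digraph \<Rightarrow> complex multiset" where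
  "graph_spectrum \<Gamma> =
    proots (char_poly (adjacency_matrix \<Gamma> (SOME vs. distinct vs \<and> set vs = pverts \<Gamma>)))"

lemma char_poly_adjacency_matrix_cong:
  assumes "distinct vs" "distinct ws" "set vs = set ws"
  shows "char_poly (adjacency_matrix \<Gamma> vs) = char_poly (adjacency_matrix \<Gamma> ws)"
proof -
  define n where "n = length vs"
  have len: "length vs = n" "length ws = n"
    using distinct_card[OF assms(1)] distinct_card[OF assms(2)] assms(3) by (simp_all add: n_def)
  define P :: "'a list \<Rightarrow> 'a list \<Rightarrow> complex mat"
    where "P = (\<lambda>xs ys. mat n n (\<lambda>(i, j). if xs ! i = ys ! j then 1 else 0))"
  have idx: "\<exists>k<n. \<forall>l<n. x = ys ! l \<longleftrightarrow> l = k"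
    if ys: "x \<in> set ys" "distinct ys" "length ys = n" for x ys
  proof -
    obtain k where k: "k < n" "ys ! k = x"
      using ys unfolding in_set_conv_nth by blast
    have "x = ys ! l \<longleftrightarrow> l = k" if "l < n" for l
      using nth_eq_iff_index_eq[of ys k l] k ys that by auto
    with k show ?thesis by blast
  qed
  have PP: "P xs ys * P ys xs = 1\<^sub>m n"
    if xs_ys: "distinct xs" "distinct ys" "set xs = set ys" "length xs = n" "length ys = n"
    for xs ys
  proof (rule eq_matI)
    fix i j assume "i < dim_row (1\<^sub>m n :: complex mat)" "j < dim_col (1\<^sub>m n :: complex mat)"
    then have ij: "i < n" "j < n" by auto
    have "xs ! i \<in> set ys" using xs_ys ij nth_mem[of i xs] by metis
    from idx[OF this xs_ys(2,5)] obtain k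
      where k: "k < n" "\<And>l. l < n \<Longrightarrow> xs ! i = ys ! l \<longleftrightarrow> l = k" by blast
    have "ys ! k = xs ! i" using k by metis
    have "(P xs ys * P ys xs) $$ (i, j) =
        (\<Sum>l\<in>{0..<n}. (if xs ! i = ys ! l then 1 else 0) * (if ys ! l = xs ! j then 1 else 0))"
      using ij by (simp add: P_def scalar_prod_def)
    also have "\<dots> = (\<Sum>l\<in>{0..<n}. if l = k then (if ys ! k = xs ! j then 1 else 0) else 0)"
      by (rule sum.cong) (auto simp: k(2))
    also have "\<dots> = (if xs ! i = xs ! j then 1 else 0)"
      using k(1) \<open>ys ! k = xs ! i\<close> by simp
    also have "\<dots> = (1\<^sub>m n :: complex mat) $$ (i, j)"
      using ij xs_ys(1,4) by (simp add: nth_eq_iff_index_eq)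
    finally show "(P xs ys * P ys xs) $$ (i, j) = (1\<^sub>m n :: complex mat) $$ (i, j)" .
  qed (auto simp: P_def)
  have comm: "adjacency_matrix \<Gamma> vs * P vs ws = P vs ws * adjacency_matrix \<Gamma> ws"
  proof (rule eq_matI)
    fix i j assume "i < dim_row (P vs ws * adjacency_matrix \<Gamma> ws)"
      "j < dim_col (P vs ws * adjacency_matrix \<Gamma> ws)"
    then have ij: "i < n" "j < n" by (auto simp: P_def adjacency_matrix_def len)
    have "vs ! i \<in> set ws" "ws ! j \<in> set vs"
      using assms(3) len ij nth_mem[of i vs] nth_mem[of j ws] by metis+
    with idx assms(1,2) len obtain k m
      where k: "k < n" "\<And>l. l < n \<Longrightarrow> vs ! i = ws ! l \<longleftrightarrow> l = k"
        and m: "m < n" "\<And>l. l < n \<Longrightarrow> ws ! j = vs ! l \<longleftrightarrow> l = m" by metis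
    have km: "ws ! k = vs ! i" "vs ! m = ws ! j" using k m by metis+
    have m': "vs ! l = ws ! j \<longleftrightarrow> l = m" if "l < n" for l
      using m(2)[OF that] by metis
    have "(adjacency_matrix \<Gamma> vs * P vs ws) $$ (i, j) =
        (\<Sum>l\<in>{0..<n}. (if (vs ! i, vs ! l) \<in> parcs \<Gamma> then 1 else 0) *
          (if vs ! l = ws ! j then 1 else 0))"
      using ij by (simp add: P_def adjacency_matrix_def scalar_prod_def len)
    also have "\<dots> =
        (\<Sum>l\<in>{0..<n}. if l = m then (if (vs ! i, vs ! m) \<in> parcs \<Gamma> then 1 else 0) else 0)"
      by (rule sum.cong) (auto simp: m')
    also have "\<dots> = (if (vs ! i, ws ! j) \<in> parcs \<Gamma> then 1 else 0)"
      using m(1) km by simp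
    also have "\<dots> =
        (\<Sum>l\<in>{0..<n}. if l = k then (if (ws ! k, ws ! j) \<in> parcs \<Gamma> then 1 else 0) else 0)"
      using k(1) km by simp
    also have "\<dots> = (\<Sum>l\<in>{0..<n}. (if vs ! i = ws ! l then 1 else 0) *
          (if (ws ! l, ws ! j) \<in> parcs \<Gamma> then 1 else 0))"
      by (rule sum.cong) (auto simp: k(2))
    also have "\<dots> = (P vs ws * adjacency_matrix \<Gamma> ws) $$ (i, j)"
      using ij by (simp add: P_def adjacency_matrix_def scalar_prod_def len)
    finally show "(adjacency_matrix \<Gamma> vs * P vs ws) $$ (i, j) =
        (P vs ws * adjacency_matrix \<Gamma> ws) $$ (i, j)" .
  qed (auto simp: P_def adjacency_matrix_def len)
  have carr: "adjacency_matrix \<Gamma> vs \<in> carrier_mat n n"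
      "adjacency_matrix \<Gamma> ws \<in> carrier_mat n n"
      "P vs ws \<in> carrier_mat n n" "P ws vs \<in> carrier_mat n n"
    by (auto simp: adjacency_matrix_def P_def len)
  have inv: "P vs ws * P ws vs = 1\<^sub>m n" "P ws vs * P vs ws = 1\<^sub>m n"
    using PP[of vs ws] PP[of ws vs] assms len by simp_all
  have "adjacency_matrix \<Gamma> vs = adjacency_matrix \<Gamma> vs * (P vs ws * P ws vs)"
    using carr(1) by (simp add: inv)
  also have "\<dots> = P vs ws * adjacency_matrix \<Gamma> ws * P ws vs"
    using assoc_mult_mat[OF carr(1,3,4)] by (simp add: comm)
  finally have "adjacency_matrix \<Gamma> vs = P vs ws * adjacency_matrix \<Gamma> ws * P ws vs" .
  then have "similar_mat (adjacency_matrix \<Gamma> vs) (adjacency_matrix \<Gamma> ws)"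
    using carr inv unfolding similar_mat_def
    by (intro exI[of _ "P vs ws"] exI[of _ "P ws vs"] similar_mat_witI[where n = n])
  then show ?thesis by (rule char_poly_similar)
qed

lemma graph_spectrum_eq:
  assumes "distinct vs" "set vs = pverts \<Gamma>"
  shows "graph_spectrum \<Gamma> = proots (char_poly (adjacency_matrix \<Gamma> vs))"
proof -
  define ws where "ws = (SOME ws. distinct ws \<and> set ws = pverts \<Gamma>)"
  have "distinct ws \<and> set ws = pverts \<Gamma>"
    unfolding ws_def by (rule someI[of _ vs]) (simp add: assms)
  then have "char_poly (adjacency_matrix \<Gamma> ws) = char_poly (adjacency_matrix \<Gamma> vs)"
    using assms by (intro char_poly_adjacency_matrix_cong) auto
  then show ?thesis by (simp add: graph_spectrum_def ws_def)
qed

end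

theory Submission
  imports Defs
begin

text \<open>
  Every element of \<open>Sz(2)\<close> has a unique normal form \<open>b ^ j a ^ i\<close> with \<open>j < 4\<close> and \<open>i < 5\<close>; on
  the nontrivial elements commuting is an equivalence relation, with one class of 4 elements (the
  powers of \<open>a\<close>) and five classes of 3 elements (the conjugates of the powers of \<open>b\<close>), and each
  class consists of powers of a single element. Elements of \<open>G\<close> whose images modulo the centre are
  powers of the same element commute, so noncentral elements of \<open>G\<close> commute exactly if their
  images do, and the commuting graph is the disjoint union of cliques of sizes
  \<open>4z, 3z, 3z, 3z, 3z, 3z\<close>, where \<open>z\<close> is the order of the centre. If \<open>N\<close> is the incidence matrix of
  vertices and cliques, then the adjacency matrix plus the identity is \<open>N N\<^sup>T\<close>, while \<open>N\<^sup>T N\<close> is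
  diagonal with the clique sizes as entries, and Sylvester's determinant identity relates their
  characteristic polynomials.
\<close>

section \<open>The spectrum of a disjoint union of cliques\<close>

text \<open>With \<open>B\<close> the block matrix with rows (xI, N) and (M, I), both
  \<open>L * B\<close> and \<open>B * R\<close> are block upper triangular, while
  \<open>det L = x ^ k\<close> and \<open>det R = 1\<close>. Computing \<open>det B\<close> through
  either product gives the identity. Keeping the powers of x on both sides avoids division.\<close>

lemma sylvester_det:
  fixes x :: "'a :: idom"
  assumes N: "N \<in> carrier_mat n k" and M: "M \<in> carrier_mat k n"
  shows "x ^ k * det (x \<cdot>\<^sub>m 1\<^sub>m n - N * M) = x ^ n * det (x \<cdot>\<^sub>m 1\<^sub>m k - M * N)"
proof -
  define B where "B = four_block_mat (x \<cdot>\<^sub>m 1\<^sub>m n) N M (1\<^sub>m k)"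
  define L where "L = four_block_mat (1\<^sub>m n) (0\<^sub>m n k) (- M) (x \<cdot>\<^sub>m 1\<^sub>m k)"
  define R where "R = four_block_mat (1\<^sub>m n) (0\<^sub>m n k) (- M) (1\<^sub>m k)"
  have carr: "B \<in> carrier_mat (n + k) (n + k)" "L \<in> carrier_mat (n + k) (n + k)"
      "R \<in> carrier_mat (n + k) (n + k)"
    using assms by (auto simp: B_def L_def R_def)
  have LB: "L * B = four_block_mat (x \<cdot>\<^sub>m 1\<^sub>m n) N (0\<^sub>m k n) (x \<cdot>\<^sub>m 1\<^sub>m k - M * N)"
    unfolding B_def L_def
    by (subst mult_four_block_mat[where ?n1.0 = n and ?n2.0 = k])
       (use assms in \<open>auto intro!: arg_cong2[where f = "\<lambda>C D. four_block_mat _ _ C D"] eq_matI\<close>)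
  have BR: "B * R = four_block_mat (x \<cdot>\<^sub>m 1\<^sub>m n - N * M) N (0\<^sub>m k n) (1\<^sub>m k)"
    unfolding B_def R_def
    by (subst mult_four_block_mat[where ?n1.0 = n and ?n2.0 = k])
       (use assms in \<open>auto intro!: arg_cong2[where f = "\<lambda>C D. four_block_mat C _ D _"] eq_matI\<close>)
  have "det L = x ^ k"
    unfolding L_def using assms by (subst det_four_block_mat_upper_right_zero) auto
  moreover have "det R = 1"
    unfolding R_def using assms by (subst det_four_block_mat_upper_right_zero) auto
  moreover have "det (L * B) = x ^ n * det (x \<cdot>\<^sub>m 1\<^sub>m k - M * N)"
    unfolding LB using assms by (subst det_four_block_mat_lower_left_zero) auto
  moreover have "det (B * R) = det (x \<cdot>\<^sub>m 1\<^sub>m n - N * M)"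
    unfolding BR using assms by (subst det_four_block_mat_lower_left_zero) auto
  ultimately show ?thesis
    using det_mult[OF carr(2,1)] det_mult[OF carr(1,3)] by simp
qed

text \<open>\<open>sylvester_det\<close> is applied over the polynomial ring with x taken to be X +
  1, written \<open>[:1, 1:]\<close>. A value c < k that \<open>f\<close> never takes is an empty
  clique and contributes the factor X + 1.\<close>

lemma char_poly_disjoint_cliques:
  fixes f :: "'a \<Rightarrow> nat"
  assumes dist: "distinct vs"
    and lt: "\<And>x. x \<in> set vs \<Longrightarrow> f x < k"
    and arcs: "\<And>x y. x \<in> set vs \<Longrightarrow> y \<in> set vs \<Longrightarrow> (x, y) \<in> parcs \<Gamma> \<longleftrightarrow> x \<noteq> y \<and> f x = f y"
  shows "[:1, 1:] ^ k * char_poly (adjacency_matrix \<Gamma> vs) =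
    [:1, 1:] ^ length vs * (\<Prod>c<k. [:1 - of_nat (card {x \<in> set vs. f x = c}), 1:])"
proof -
  define n where "n = length vs"
  define N :: "complex poly mat" where "N = mat n k (\<lambda>(i, c). if f (vs ! i) = c then 1 else 0)"
  define M where "M = transpose_mat N"
  have carr: "N \<in> carrier_mat n k" "M \<in> carrier_mat k n"
    by (auto simp: N_def M_def)
  have mem: "vs ! i \<in> set vs" if "i < n" for i using that by (simp add: n_def)
  have NM: "char_poly_matrix (adjacency_matrix \<Gamma> vs) = [:1, 1:] \<cdot>\<^sub>m 1\<^sub>m n - N * M"
  proof (rule eq_matI)
    fix i j assume "i < dim_row ([:1, 1:] \<cdot>\<^sub>m 1\<^sub>m n - N * M)" "j < dim_col ([:1, 1:] \<cdot>\<^sub>m 1\<^sub>m n - N * M)"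
    then have ij: "i < n" "j < n" using carr by auto
    have "(N * M) $$ (i, j) =
        (\<Sum>c\<in>{0..<k}. (if f (vs ! i) = c then 1 else 0) * (if f (vs ! j) = c then 1 else 0))"
      using ij by (simp add: N_def M_def scalar_prod_def)
    also have "\<dots> = (\<Sum>c\<in>{0..<k}. if c = f (vs ! i) then (if f (vs ! i) = f (vs ! j) then 1 else 0) else 0)"
      by (rule sum.cong) auto
    also have "\<dots> = (if f (vs ! i) = f (vs ! j) then 1 else 0)"
      using lt[OF mem[OF ij(1)]] by simp
    finally have "(N * M) $$ (i, j) = (if f (vs ! i) = f (vs ! j) then 1 else 0)" .
    \<comment> \<open>\<open>N * M\<close> has ones on the diagonal, the adjacency matrix has zeros
      there. The shift from X to X + 1 makes up for this.\<close>
    then show "char_poly_matrix (adjacency_matrix \<Gamma> vs) $$ (i, j) = ([:1, 1:] \<cdot>\<^sub>m 1\<^sub>m n - N * M) $$ (i, j)"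
      using ij carr arcs[OF mem mem] dist
      by (auto simp: char_poly_matrix_def adjacency_matrix_def n_def nth_eq_iff_index_eq one_pCons)
  qed (use carr in \<open>auto simp: char_poly_matrix_def adjacency_matrix_def n_def\<close>)
  have count: "(\<Sum>i\<in>{0..<n}. if f (vs ! i) = c then 1 else 0) =
      (of_nat (card {x \<in> set vs. f x = c}) :: complex poly)" for c
  proof -
    have "(\<Sum>x\<in>set vs. if f x = c then 1 else 0) =
        (\<Sum>i\<in>{0..<n}. if f (vs ! i) = c then 1 else 0 :: complex poly)"
      by (rule sum.reindex_bij_betw[symmetric]) (simp add: n_def bij_betw_nth dist atLeast0LessThan)
    then show ?thesis by (simp add: sum.If_cases Int_def)
  qed
  have MN: "[:1, 1:] \<cdot>\<^sub>m 1\<^sub>m k - M * N =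
      mat_diag k (\<lambda>c. [:1 - of_nat (card {x \<in> set vs. f x = c}), 1:])" (is "?D = ?E")
  proof (rule eq_matI)
    fix c d assume "c < dim_row ?E" "d < dim_col ?E"
    then have cd: "c < k" "d < k" by (auto simp: mat_diag_def)
    have "(M * N) $$ (c, d) =
        (\<Sum>i\<in>{0..<n}. (if f (vs ! i) = c then 1 else 0) * (if f (vs ! i) = d then 1 else 0))"
      using cd by (simp add: N_def M_def scalar_prod_def)
    also have "\<dots> = (\<Sum>i\<in>{0..<n}. if c = d then (if f (vs ! i) = c then 1 else 0) else 0)"
      by (rule sum.cong) auto
    also have "\<dots> = (if c = d then of_nat (card {x \<in> set vs. f x = c}) else 0)"
      by (simp add: count)
    finally show "?D $$ (c, d) = ?E $$ (c, d)"
      using cd carr by (simp add: mat_diag_def of_nat_poly one_pCons)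
  qed (use carr in \<open>auto simp: mat_diag_def\<close>)
  have "det ?E = (\<Prod>c<k. [:1 - of_nat (card {x \<in> set vs. f x = c}), 1:])"
    by (subst det_upper_triangular[where n = k])
       (auto simp: prod_list_diag_prod mat_diag_def atLeast0LessThan)
  then show ?thesis
    using sylvester_det[OF carr, of "[:1, 1:]"] by (simp add: char_poly_def NM MN n_def)
qed

section \<open>Normal forms in Sz(2)\<close>

type_synonym sz2_nf = "nat \<times> nat"

definition nf_set :: "sz2_nf set" where
  "nf_set = {0..<4} \<times> {0..<5}"

text \<open>The pair (j, i) stands for b^j a^i. The relation b^-1 a b = a^2 gives a^i b^j = b^j a^(i
  2^j), hence the factor \<open>2 ^ fst q\<close>.\<close>

definition nf_mult :: "sz2_nf \<Rightarrow> sz2_nf \<Rightarrow> sz2_nf" where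
  "nf_mult p q = ((fst p + fst q) mod 4, (snd p * 2 ^ fst q + snd q) mod 5)"

text \<open>This holds because 16 = 1 modulo 5. It makes reducing the exponent of b modulo 4
  compatible with the arithmetic modulo 5 in the second component, which is what associativity of
  \<open>nf_mult\<close> requires.\<close>

lemma two_power_mod_5: "(2 :: nat) ^ (n mod 4) mod 5 = 2 ^ n mod 5"
proof -
  have "(2 :: nat) ^ n = 2 ^ (4 * (n div 4) + n mod 4)" by simp
  also have "\<dots> = 16 ^ (n div 4) * 2 ^ (n mod 4)" by (simp only: power_add power_mult) simp
  also have "\<dots> mod 5 = (16 mod 5) ^ (n div 4) * 2 ^ (n mod 4) mod 5"
    by (metis mod_mult_left_eq power_mod)
  finally show ?thesis by simp
qed

lemma nf_mult_assoc: "nf_mult (nf_mult p q) r = nf_mult p (nf_mult q r)"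
proof -
  obtain j i j' i' j'' i'' where [simp]: "p = (j, i)" "q = (j', i')" "r = (j'', i'')"
    by (cases p, cases q, cases r)
  have "((i * 2 ^ j' + i') mod 5 * 2 ^ j'' + i'') mod 5 = (i * 2 ^ (j' + j'') + (i' * 2 ^ j'' + i'')) mod 5"
  proof -
    have "((i * 2 ^ j' + i') mod 5 * 2 ^ j'' + i'') mod 5 = ((i * 2 ^ j' + i') * 2 ^ j'' + i'') mod 5"
      by (metis mod_add_left_eq mod_mult_left_eq)
    then show ?thesis by (simp only: power_add algebra_simps)
  qed
  also have "\<dots> = (i * (2 ^ ((j' + j'') mod 4) mod 5) + (i' * 2 ^ j'' + i'')) mod 5"
    unfolding two_power_mod_5 by (metis mod_add_left_eq mod_mult_right_eq)
  also have "\<dots> = (i * 2 ^ ((j' + j'') mod 4) + (i' * 2 ^ j'' + i'') mod 5) mod 5"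
    by (metis mod_add_left_eq mod_add_right_eq mod_mult_right_eq)
  finally show ?thesis by (simp add: nf_mult_def mod_simps add.assoc)
qed

lemma nf_mult_closed [simp]: "nf_mult p q \<in> nf_set"
  by (simp add: nf_mult_def nf_set_def)

lemma nf_mult_0_right: "p \<in> nf_set \<Longrightarrow> nf_mult p (0, 0) = p"
  by (auto simp: nf_mult_def nf_set_def)

section \<open>Evaluating words to normal forms\<close>

fun nf_letter :: "sz2_gen \<times> bool \<Rightarrow> sz2_nf" where
  "nf_letter (Sz2_a, s) = (0, if s then 1 else 4)"
| "nf_letter (Sz2_b, s) = (if s then 1 else 3, 0)"

text \<open>The inverse letters are read as a^4 and b^3, so only natural exponents occur.\<close>

definition word_nf :: "sz2_gen word \<Rightarrow> sz2_nf" where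
  "word_nf w = foldl (\<lambda>p l. nf_mult p (nf_letter l)) (0, 0) w"

definition nf_word :: "sz2_nf \<Rightarrow> sz2_gen word" where
  "nf_word p = replicate (fst p) (Sz2_b, True) @ replicate (snd p) (Sz2_a, True)"

abbreviation "wa \<equiv> (Sz2_a, True)"
abbreviation "wb \<equiv> (Sz2_b, True)"

definition sz2_rels :: "(sz2_gen word \<times> sz2_gen word) set" where
  "sz2_rels = {(replicate 5 wa, []), (replicate 4 wb, []), ([(Sz2_b, False), wa, wb], [wa, wa])}"

lemma Sz2_presented: "Sz2 = presented_group sz2_rels"
proof -
  have "word_pow [x] n = replicate n x" for x :: "sz2_gen \<times> bool" and n
    by (induction n) (simp_all add: word_pow_def)
  then show ?thesis
    by (simp add: Sz2_def sz2_rels_def Let_def word_gen_def word_inv_def numeral_2_eq_2)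
qed

lemma word_nf_Nil: "word_nf [] = (0, 0)"
  by (simp add: word_nf_def)

lemma word_nf_snoc: "word_nf (w @ [l]) = nf_mult (word_nf w) (nf_letter l)"
  by (simp add: word_nf_def)

lemma word_nf_closed [simp]: "word_nf w \<in> nf_set"
  by (cases w rule: rev_cases) (auto simp: word_nf_snoc word_nf_Nil, simp add: nf_set_def)

lemma word_nf_append: "word_nf (u @ v) = nf_mult (word_nf u) (word_nf v)"
proof (induction v rule: rev_induct)
  case Nil
  show ?case by (simp add: nf_mult_0_right word_nf_Nil)
next
  case (snoc l v)
  then show ?case by (simp add: word_nf_snoc nf_mult_assoc flip: append_assoc)
qed

lemma word_nf_replicate_a: "word_nf (replicate n wa) = (0, n mod 5)"
  by (induction n)
     (simp_all add: word_nf_Nil word_nf_snoc nf_mult_def mod_simps flip: replicate_append_same)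

lemma word_nf_replicate_b: "word_nf (replicate n wb) = (n mod 4, 0)"
  by (induction n)
     (simp_all add: word_nf_Nil word_nf_snoc nf_mult_def mod_simps flip: replicate_append_same)

text \<open>Soundness: free cancellation and the three relations all hold for normal forms. Hence
  words with different normal forms represent different elements, and the presentation does not
  collapse.\<close>

lemma word_nf_cong: "word_eq sz2_rels v w \<Longrightarrow> word_nf v = word_nf w"
proof (induction rule: word_eq.induct)
  case (cancel u x s v)
  have "word_nf [(x, s), (x, \<not> s)] = (0, 0)"
    by (cases x; cases s) (simp_all add: word_nf_def nf_mult_def)
  then have "word_nf (u @ [(x, s), (x, \<not> s)]) = word_nf u"
    unfolding word_nf_append[of u] by (simp add: nf_mult_0_right)
  then show ?case
    using word_nf_append[of "u @ [(x, s), (x, \<not> s)]" v] word_nf_append[of u v] by simp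
next
  case (relation l r u v)
  have "word_nf l = word_nf r"
    using relation unfolding sz2_rels_def
    by (elim insertE emptyE Pair_inject)
       (simp_all only: word_nf_replicate_a word_nf_replicate_b, simp_all add: word_nf_def nf_mult_def)
  then show ?case by (simp add: word_nf_append)
qed auto

section \<open>Rewriting words to normal form by the relations\<close>

lemma word_eq_gen_inverse:
  assumes "word_eq R (replicate (Suc n) (x, True)) []"
  shows "word_eq R [(x, False)] (replicate n (x, True))"
proof -
  have "word_eq R ([(x, False)] @ replicate (Suc n) (x, True)) ([(x, False)] @ [])"
    by (rule word_eq_append_left) fact
  moreover have "word_eq R ([] @ [(x, False), (x, \<not> False)] @ replicate n (x, True))
      ([] @ replicate n (x, True))"
    by (rule word_eq.cancel)
  ultimately show ?thesis by (auto intro: word_eq.sym word_eq.trans)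
qed

declare word_eq.trans [trans]

abbreviation sz2_eq (infix \<open>\<approx>\<close> 50) where "sz2_eq \<equiv> word_eq sz2_rels"
lemma sz2_a_order: "replicate 5 wa \<approx> []"
  using word_eq.relation[of "replicate 5 wa" "[]" sz2_rels "[]" "[]"] by (simp add: sz2_rels_def)

lemma sz2_b_order: "replicate 4 wb \<approx> []"
  using word_eq.relation[of "replicate 4 wb" "[]" sz2_rels "[]" "[]"] by (simp add: sz2_rels_def)

lemma sz2_a_b: "[wa, wb] \<approx> [wb, wa, wa]"
proof -
  have "[(Sz2_b, False), wa, wb] \<approx> [wa, wa]"
    using word_eq.relation[of "[(Sz2_b, False), wa, wb]" "[wa, wa]" sz2_rels "[]" "[]"]
    by (simp add: sz2_rels_def)
  from word_eq_append_left[OF this, of "[wb]"]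
  have "[wb, (Sz2_b, False), wa, wb] \<approx> [wb, wa, wa]" by simp
  moreover have "[wb, (Sz2_b, False), wa, wb] \<approx> [wa, wb]"
    using word_eq.cancel[of sz2_rels "[]" Sz2_b True "[wa, wb]"] by simp
  ultimately show ?thesis by (blast intro: word_eq.sym word_eq.trans)
qed

text \<open>Each a that b passes on its way to the left is doubled, by
  \<open>sz2_a_b\<close>.\<close>

lemma sz2_a_pow_b: "replicate i wa @ [wb] \<approx> wb # replicate (2 * i) wa"
proof (induction i)
  case 0
  show ?case by (simp add: word_eq.refl)
next
  case (Suc i)
  have "[wa] @ replicate i wa @ [wb] \<approx> [wa] @ wb # replicate (2 * i) wa"
    by (rule word_eq_append_left) fact
  moreover have "[wa, wb] @ replicate (2 * i) wa \<approx> [wb, wa, wa] @ replicate (2 * i) wa"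
    by (rule word_eq_append_right) (rule sz2_a_b)
  ultimately show ?case by (auto intro: word_eq.trans)
qed

lemma word_eq_replicate_mod:
  assumes "word_eq R (replicate m x) []"
  shows "word_eq R (replicate n x) (replicate (n mod m) x)"
proof -
  have "word_eq R (replicate (q * m + r) x) (replicate r x)" for q r
  proof (induction q)
    case 0
    show ?case by (simp add: word_eq.refl)
  next
    case (Suc q)
    have "word_eq R (replicate m x @ replicate (q * m + r) x) ([] @ replicate (q * m + r) x)"
      by (rule word_eq_append_right) fact
    with Suc show ?case by (auto simp: add.assoc simp flip: replicate_add intro: word_eq.trans)
  qed
  from this[of "n div m" "n mod m"] show ?thesis by simp
qed

text \<open>An appended a joins the block of a's directly. An appended b is first moved to the left
  of that block, which doubles its length. The lengths are then reduced modulo 4 and 5.\<close>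

lemma nf_word_snoc_True: "nf_word p @ [(x, True)] \<approx> nf_word (nf_mult p (nf_letter (x, True)))"
proof (cases x)
  case Sz2_a
  have "replicate (fst p) wb @ replicate (Suc (snd p)) wa \<approx>
      replicate (fst p mod 4) wb @ replicate (Suc (snd p) mod 5) wa"
    by (intro word_eq_append word_eq_replicate_mod sz2_a_order sz2_b_order)
  then show ?thesis
    by (simp add: Sz2_a nf_word_def nf_mult_def replicate_append_same)
next
  case Sz2_b
  have "replicate (fst p) wb @ replicate (snd p) wa @ [wb] \<approx>
      replicate (fst p) wb @ wb # replicate (2 * snd p) wa"
    by (intro word_eq_append_left sz2_a_pow_b)
  moreover have "replicate (Suc (fst p)) wb @ replicate (2 * snd p) wa \<approx>
      replicate (Suc (fst p) mod 4) wb @ replicate (2 * snd p mod 5) wa"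
    by (intro word_eq_append word_eq_replicate_mod sz2_a_order sz2_b_order)
  ultimately show ?thesis
    by (auto simp: Sz2_b nf_word_def nf_mult_def replicate_app_Cons_same mult.commute intro: word_eq.trans)
qed

lemma nf_word_append_replicate:
  assumes "p \<in> nf_set"
  shows "nf_word p @ replicate n (x, True) \<approx> nf_word (nf_mult p (word_nf (replicate n (x, True))))"
proof (induction n)
  case 0
  show ?case by (simp add: word_nf_Nil nf_mult_0_right assms word_eq.refl)
next
  case (Suc n)
  let ?r = "replicate n (x, True)"
  have "(nf_word p @ ?r) @ [(x, True)] \<approx> nf_word (nf_mult p (word_nf ?r)) @ [(x, True)]"
    by (rule word_eq_append_right) fact
  also have "\<dots> \<approx> nf_word (nf_mult (nf_mult p (word_nf ?r)) (nf_letter (x, True)))"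
    by (rule nf_word_snoc_True)
  finally show ?case
    by (simp add: word_nf_snoc nf_mult_assoc flip: replicate_append_same)
qed

lemma sz2_inverse: "\<exists>n. [(x, False)] \<approx> replicate n (x, True)"
proof (cases x)
  case Sz2_a
  have "replicate (Suc 4) wa \<approx> []" using sz2_a_order by simp
  then show ?thesis unfolding Sz2_a by (blast intro: word_eq_gen_inverse)
next
  case Sz2_b
  have "replicate (Suc 3) wb \<approx> []" using sz2_b_order by simp
  then show ?thesis unfolding Sz2_b by (blast intro: word_eq_gen_inverse)
qed

text \<open>Completeness: the relations reduce every word to its normal form. Together with
  \<open>word_nf_cong\<close> this solves the word problem.\<close>

lemma nf_word_word_nf: "nf_word (word_nf w) \<approx> w"
proof (induction w rule: rev_induct)
  case Nil
  show ?case by (simp add: nf_word_def word_nf_def word_eq.refl)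
next
  case (snoc l w)
  \<comment> \<open>A positive letter is its own first power; an inverse letter is a positive power
    by \<open>sz2_inverse\<close>. So appending positive letters suffices.\<close>
  obtain x n where l: "[l] \<approx> replicate n (x, True)"
    by (metis (full_types) old.prod.exhaust replicate_0 replicate_Suc sz2_inverse word_eq.refl)
  have "w @ [l] \<approx> nf_word (word_nf w) @ replicate n (x, True)"
    by (intro word_eq_append l word_eq.sym[OF snoc.IH])
  also have "\<dots> \<approx> nf_word (nf_mult (word_nf w) (word_nf (replicate n (x, True))))"
    by (rule nf_word_append_replicate) simp
  \<comment> \<open>By soundness the positive power has the same normal form as the letter it
    replaces.\<close>
  also have "word_nf (replicate n (x, True)) = word_nf [l]"
    by (rule word_nf_cong[symmetric]) fact
  finally show ?case by (simp add: word_nf_append word_eq.sym)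
qed

lemma word_eq_sz2_iff: "v \<approx> w \<longleftrightarrow> word_nf v = word_nf w"
  by (metis nf_word_word_nf word_eq.sym word_eq.trans word_nf_cong)

lemma word_nf_nf_word: "p \<in> nf_set \<Longrightarrow> word_nf (nf_word p) = p"
  by (auto simp: nf_word_def word_nf_append word_nf_replicate_a word_nf_replicate_b nf_mult_def nf_set_def)

section \<open>Identification of Sz(2) with the twenty normal forms\<close>

definition sz2_nf :: "sz2_gen word set \<Rightarrow> sz2_nf" where
  "sz2_nf A = the_elem (word_nf ` A)"

text \<open>\<open>word_nf\<close> is constant on a class, so \<open>the_elem\<close> is applied to
  a singleton.\<close>

lemma sz2_nf_class: "sz2_nf (word_rel sz2_rels `` {w}) = word_nf w"
proof -
  have "word_nf ` (word_rel sz2_rels `` {w}) = {word_nf w}"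
    by (auto simp: word_rel_def word_eq_sz2_iff)
  then show ?thesis by (simp add: sz2_nf_def)
qed

lemma Sz2_cases:
  assumes "A \<in> carrier Sz2"
  obtains w where "A = word_rel sz2_rels `` {w}"
  using assms by (auto simp: Sz2_presented presented_group_def elim!: quotientE)

lemma sz2_nf_mult:
  assumes "A \<in> carrier Sz2" "B \<in> carrier Sz2"
  shows "sz2_nf (A \<otimes>\<^bsub>Sz2\<^esub> B) = nf_mult (sz2_nf A) (sz2_nf B)"
proof -
  from assms obtain v w where "A = word_rel sz2_rels `` {v}" "B = word_rel sz2_rels `` {w}"
    by (elim Sz2_cases)
  then show ?thesis
    by (simp add: Sz2_presented presented_group_mult sz2_nf_class word_nf_append)
qed

lemma bij_betw_sz2_nf: "bij_betw sz2_nf (carrier Sz2) nf_set"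
proof (rule bij_betw_imageI)
  show "inj_on sz2_nf (carrier Sz2)"
  proof (rule inj_onI, elim Sz2_cases)
    fix A B v w
    assume "sz2_nf A = sz2_nf B" and A: "A = word_rel sz2_rels `` {v}" "B = word_rel sz2_rels `` {w}"
    then have "v \<approx> w" by (simp add: sz2_nf_class word_eq_sz2_iff)
    then show "A = B"
      unfolding A by (intro equiv_class_eq[OF equiv_word_rel]) (simp add: word_rel_def)
  qed
  show "sz2_nf ` carrier Sz2 = nf_set"
  proof (intro equalityI subsetI)
    fix p assume "p \<in> sz2_nf ` carrier Sz2"
    then show "p \<in> nf_set" by (auto elim!: Sz2_cases simp: sz2_nf_class)
  next
    fix p assume "p \<in> nf_set"
    then have "p = sz2_nf (word_rel sz2_rels `` {nf_word p})"
      by (simp add: sz2_nf_class word_nf_nf_word)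
    then show "p \<in> sz2_nf ` carrier Sz2"
      by (auto simp: Sz2_presented presented_group_def intro: quotientI)
  qed
qed

lemma sz2_nf_one: "sz2_nf \<one>\<^bsub>Sz2\<^esub> = (0, 0)"
  by (simp add: Sz2_presented presented_group_def sz2_nf_class word_nf_Nil)

section \<open>Commuting classes of normal forms\<close>

text \<open>
  The pair \<open>(j, i)\<close> acts on the integers modulo 5 by \<open>x \<mapsto> 2 ^ j * x + i\<close>. The nontrivial
  translations have class 0, and the other elements have class \<open>x + 1\<close> where \<open>x\<close> is their
  fixed point.
\<close>

definition nf_class :: "sz2_nf \<Rightarrow> nat" where
  "nf_class p = (if fst p = 0 then 0 else Suc ((5 - fst p) * snd p mod 5))"

text \<open>Class 0 is generated by a. For 0 < c < 6 the map x -> 2x + i fixes c - 1 exactly if i =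
  1 - c modulo 5, and 6 - c represents this residue without truncated subtraction; the powers of
  this map form the stabilizer of c - 1.\<close>

definition class_gen :: "nat \<Rightarrow> sz2_nf" where
  "class_gen c = (if c = 0 then (0, 1) else (1, (6 - c) mod 5))"

lemma nf_set_list: "nf_set = set (List.product [0..<4] [0..<5])"
  by (auto simp: nf_set_def)

text \<open>Commuting affine maps preserve each other's fixed point sets, so a map with a unique
  fixed point commutes with no nontrivial translation, and only with maps fixing the same point.
  Conversely, translations commute, and so do the elements of a cyclic stabilizer. The proof checks
  all pairs by evaluation.\<close>

lemma nf_mult_commute_iff:
  assumes "p \<in> nf_set" "q \<in> nf_set" "p \<noteq> (0, 0)" "q \<noteq> (0, 0)"
  shows "nf_mult p q = nf_mult q p \<longleftrightarrow> nf_class p = nf_class q"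
proof -
  have "\<forall>p\<in>set (List.product [0..<4] [0..<5]). \<forall>q\<in>set (List.product [0..<4] [0..<5]).
      p \<noteq> (0, 0) \<longrightarrow> q \<noteq> (0, 0) \<longrightarrow> nf_mult p q = nf_mult q p \<longleftrightarrow> nf_class p = nf_class q"
    by code_simp
  with assms show ?thesis by (simp only: nf_set_list) blast
qed

text \<open>The translations form a cyclic group of order 5 and the stabilizers are cyclic of order
  4, so exponents below 5 suffice in the search.\<close>

lemma nf_power_class_gen:
  assumes "p \<in> nf_set" "p \<noteq> (0, 0)"
  obtains m where "p = ((\<lambda>q. nf_mult q (class_gen (nf_class p))) ^^ m) (0, 0)"
proof -
  have "\<forall>p\<in>set (List.product [0..<4] [0..<5]). p \<noteq> (0, 0) \<longrightarrow>
      (\<exists>m\<in>set [0..<5]. p = ((\<lambda>q. nf_mult q (class_gen (nf_class p))) ^^ m) (0, 0))"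
    by code_simp
  with assms that show ?thesis by (simp only: nf_set_list) blast
qed

lemma nf_class_less: "nf_class p < 6"
  by (simp add: nf_class_def) 

lemma class_gen_closed: "c < 6 \<Longrightarrow> class_gen c \<in> nf_set"
  by (auto simp: class_gen_def nf_set_def)

lemma card_nf_class:
  assumes "c < 6"
  shows "card {p \<in> nf_set - {(0, 0)}. nf_class p = c} = (if c = 0 then 4 else 3)"
proof -
  have "\<forall>c\<in>set [0..<6]. card (set (filter (\<lambda>p. p \<noteq> (0, 0) \<and> nf_class p = c) (List.product [0..<4] [0..<5])))
      = (if c = 0 then 4 else 3)"
    by code_simp
  moreover have "{p \<in> nf_set - {(0, 0)}. nf_class p = c} =
      set (filter (\<lambda>p. p \<noteq> (0, 0) \<and> nf_class p = c) (List.product [0..<4] [0..<5]))"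
    unfolding nf_set_list by (simp only: set_filter) blast
  ultimately show ?thesis using assms by simp
qed

section \<open>Commuting in a group with central quotient Sz(2)\<close>

lemma centerI:
  assumes "z \<in> carrier G" "\<And>x. x \<in> carrier G \<Longrightarrow> z \<otimes>\<^bsub>G\<^esub> x = x \<otimes>\<^bsub>G\<^esub> z"
  shows "z \<in> center G"
  using assms unfolding center_def by blast

lemma center_closed: "z \<in> center G \<Longrightarrow> z \<in> carrier G"
  unfolding center_def by blast

lemma center_commute: "z \<in> center G \<Longrightarrow> x \<in> carrier G \<Longrightarrow> z \<otimes>\<^bsub>G\<^esub> x = x \<otimes>\<^bsub>G\<^esub> z"
  unfolding center_def by blast

lemma (in group) center_normal: "center G \<lhd> G"
proof -
  have "subgroup (center G) G"
  proof (rule subgroupI)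
    have "\<one> \<in> center G" by (rule centerI) simp_all
    then show "center G \<noteq> {}" by blast
  next
    fix a assume a: "a \<in> center G"
    show "inv a \<in> center G"
    proof (rule centerI)
      fix x assume x: "x \<in> carrier G"
      \<comment> \<open>Inverting both sides of the commutation of a with the inverse of x gives
        that of the inverse of a with x.\<close>
      have "inv (inv x \<otimes> a) = inv (a \<otimes> inv x)"
        by (simp only: center_commute[OF a inv_closed[OF x]])
      with x center_closed[OF a] show "inv a \<otimes> x = x \<otimes> inv a"
        by (simp only: inv_mult_group inv_closed inv_inv)
    qed (use center_closed[OF a] in simp)
  next
    fix a b assume ab: "a \<in> center G" "b \<in> center G"
    note carr = ab[THEN center_closed]
    show "a \<otimes> b \<in> center G"
    proof (rule centerI)
      fix x assume x: "x \<in> carrier G"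
      have "a \<otimes> b \<otimes> x = a \<otimes> (b \<otimes> x)" using carr x by (rule m_assoc)
      also have "b \<otimes> x = x \<otimes> b" using ab(2) x by (rule center_commute)
      also have "a \<otimes> (x \<otimes> b) = a \<otimes> x \<otimes> b" using carr x by (simp only: m_assoc)
      also have "a \<otimes> x = x \<otimes> a" using ab(1) x by (rule center_commute)
      finally show "a \<otimes> b \<otimes> x = x \<otimes> (a \<otimes> b)" using carr x by (simp only: m_assoc)
    qed (use carr in simp)
  qed (auto intro: center_closed)
  then show ?thesis
    by (rule normalI) (auto simp: r_coset_def l_coset_def center_commute)
qed

text \<open>This turns the abstract isomorphism into a map on \<open>G\<close> itself with values in
  the concrete normal forms, whose fibres are the cosets of the centre.\<close>

lemma (in group) center_Mod_Sz2_hom: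
  assumes iso: "(G Mod center G) \<cong> Sz2"
  obtains \<pi> where "\<pi> ` carrier G = nf_set"
    and "\<And>x y. x \<in> carrier G \<Longrightarrow> y \<in> carrier G \<Longrightarrow> \<pi> (x \<otimes> y) = nf_mult (\<pi> x) (\<pi> y)"
    and "\<And>x y. x \<in> carrier G \<Longrightarrow> y \<in> carrier G \<Longrightarrow>
      \<pi> x = \<pi> y \<longleftrightarrow> center G #> x = center G #> y"
    and "\<pi> \<one> = (0, 0)"
proof -
  interpret normal "center G" G by (rule center_normal)
  interpret Q: group "G Mod center G" by (rule factorgroup_is_group)
  interpret S: group Sz2 by (simp add: Sz2_presented group_presented_group)
  from iso obtain h where h: "h \<in> hom (G Mod center G) Sz2"
      "bij_betw h (carrier (G Mod center G)) (carrier Sz2)"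
    by (auto simp: is_iso_def iso_def)
  have carr: "carrier (G Mod center G) = (\<lambda>x. center G #> x) ` carrier G"
    by (auto simp: FactGroup_def RCOSETS_def)
  define \<pi> where "\<pi> = (\<lambda>x. sz2_nf (h (center G #> x)))"
  have bij: "bij_betw (sz2_nf \<circ> h) ((\<lambda>x. center G #> x) ` carrier G) nf_set"
    using bij_betw_trans[OF h(2) bij_betw_sz2_nf] by (simp add: carr)
  show thesis
  proof
    show "\<pi> ` carrier G = nf_set"
      using bij by (auto simp: \<pi>_def bij_betw_def image_image)
  next
    fix x y assume xy: "x \<in> carrier G" "y \<in> carrier G"
    have Q: "center G #> x \<in> carrier (G Mod center G)" "center G #> y \<in> carrier (G Mod center G)"
      using xy by (auto simp: carr)
    have "h (center G #> (x \<otimes> y)) = h (center G #> x) \<otimes>\<^bsub>Sz2\<^esub> h (center G #> y)"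
      using hom_mult[OF h(1) Q] xy by (simp add: FactGroup_def rcos_sum)
    then show "\<pi> (x \<otimes> y) = nf_mult (\<pi> x) (\<pi> y)"
      using sz2_nf_mult hom_in_carrier[OF h(1) Q(1)] hom_in_carrier[OF h(1) Q(2)]
      by (simp add: \<pi>_def)
    show "\<pi> x = \<pi> y \<longleftrightarrow> center G #> x = center G #> y"
      using inj_on_eq_iff[OF bij_betw_imp_inj_on[OF bij], of "center G #> x" "center G #> y"] xy
      by (simp add: \<pi>_def)
  next
    have "h \<one>\<^bsub>G Mod center G\<^esub> = \<one>\<^bsub>Sz2\<^esub>"
      using h(1) by (rule hom_one) unfold_locales
    then show "\<pi> \<one> = (0, 0)"
      by (simp add: \<pi>_def FactGroup_def coset_mult_one[OF subset] sz2_nf_one)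
  qed
qed

text \<open>The central factors can be moved to the front, and powers of one element
  commute.\<close>

lemma (in group) commute_center_translates_of_powers:
  assumes "x \<in> center G #> (g [^] (m :: nat))" "y \<in> center G #> (g [^] (n :: nat))" "g \<in> carrier G"
  shows "x \<otimes> y = y \<otimes> x"
proof -
  from assms obtain z w where z: "z \<in> center G" "x = z \<otimes> g [^] m"
    and w: "w \<in> center G" "y = w \<otimes> g [^] n"
    by (auto simp: r_coset_def)
  have carr: "z \<in> carrier G" "w \<in> carrier G" "g [^] m \<in> carrier G" "g [^] n \<in> carrier G"
    using z w assms(3) by (auto intro: center_closed)
  have comm: "g [^] m \<otimes> w = w \<otimes> g [^] m" "g [^] n \<otimes> z = z \<otimes> g [^] n" "w \<otimes> z = z \<otimes> w"
    using z w carr by (auto intro: center_commute center_commute[symmetric])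
  have "g [^] n \<otimes> g [^] m = g [^] m \<otimes> g [^] n"
    using assms(3) by (simp add: nat_pow_mult add.commute)
  moreover have "x \<otimes> y = z \<otimes> (g [^] m \<otimes> w) \<otimes> g [^] n"
    using z(2) w(2) carr by (simp add: m_assoc)
  then have "x \<otimes> y = z \<otimes> w \<otimes> (g [^] m \<otimes> g [^] n)"
    unfolding comm(1) using carr by (simp add: m_assoc)
  moreover have "y \<otimes> x = w \<otimes> (g [^] n \<otimes> z) \<otimes> g [^] m"
    using z(2) w(2) carr by (simp add: m_assoc)
  then have "y \<otimes> x = w \<otimes> z \<otimes> (g [^] n \<otimes> g [^] m)"
    unfolding comm(2) using carr by (simp add: m_assoc)
  ultimately show ?thesis by (simp only: comm(3))
qed

lemma (in group) commuting_classes: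
  assumes "finite (carrier G)" "(G Mod center G) \<cong> Sz2"
  obtains cls :: "'a \<Rightarrow> nat" where "\<And>x. cls x < 6"
    and "\<And>x y. x \<in> carrier G - center G \<Longrightarrow> y \<in> carrier G - center G \<Longrightarrow>
      x \<otimes> y = y \<otimes> x \<longleftrightarrow> cls x = cls y"
    and "\<And>c. c < 6 \<Longrightarrow> card {x \<in> carrier G - center G. cls x = c} =
      (if c = 0 then 4 else 3) * card (center G)"
proof -
  interpret normal "center G" G by (rule center_normal)
  obtain \<pi> where img: "\<pi> ` carrier G = nf_set"
    and mult: "\<And>x y. x \<in> carrier G \<Longrightarrow> y \<in> carrier G \<Longrightarrow> \<pi> (x \<otimes> y) = nf_mult (\<pi> x) (\<pi> y)"
    and eq_iff: "\<And>x y. x \<in> carrier G \<Longrightarrow> y \<in> carrier G \<Longrightarrow>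
      \<pi> x = \<pi> y \<longleftrightarrow> center G #> x = center G #> y"
    and one: "\<pi> \<one> = (0, 0)"
    using center_Mod_Sz2_hom[OF assms(2)] by blast
  define V where "V = carrier G - center G"
  define z where "z = card (center G)"
  define cls where "cls = nf_class \<circ> \<pi>"
  have nf: "\<pi> x \<in> nf_set" if "x \<in> carrier G" for x using img that by auto
  have surj: "\<exists>g\<in>carrier G. \<pi> g = p" if "p \<in> nf_set" for p
    using that unfolding img[symmetric] by (auto elim!: imageE)
  \<comment> \<open>Fibres being cosets serves twice: each has \<open>z\<close> elements, and equal
    images differ by a central factor.\<close>
  have fibre: "{x \<in> carrier G. \<pi> x = \<pi> g} = center G #> g" if "g \<in> carrier G" for g
  proof (rule Set.set_eqI, rule iffI)
    fix x assume "x \<in> {x \<in> carrier G. \<pi> x = \<pi> g}"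
    then show "x \<in> center G #> g"
      using that eq_iff[of x g] rcos_self[OF _ is_subgroup, of x] by simp
  next
    fix x assume x: "x \<in> center G #> g"
    then have "x \<in> carrier G" using r_coset_subset_G[OF subset that] by blast
    moreover from this have "\<pi> x = \<pi> g \<longleftrightarrow> center G #> x = center G #> g"
      using that by (rule eq_iff)
    then have "\<pi> x = \<pi> g"
      using repr_independence[OF x that is_subgroup] by blast
    ultimately show "x \<in> {x \<in> carrier G. \<pi> x = \<pi> g}" by simp
  qed
  have card_fibre: "card {x \<in> carrier G. \<pi> x = p} = z" if p: "p \<in> nf_set" for p
  proof -
    obtain g where "g \<in> carrier G" "\<pi> g = p" using surj[OF p] by blast
    then show ?thesis
      using fibre[of g] card_rcosets_equal[OF _ subset, of "center G #> g"]
      by (simp add: z_def rcosetsI subset)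
  qed
  \<comment> \<open>The fibre over the identity is the centre itself, so the vertices are the
    elements with nontrivial image.\<close>
  have V: "V = {x \<in> carrier G. \<pi> x \<noteq> (0, 0)}"
    using fibre[OF center_closed[OF one_closed]] coset_mult_one[OF subset] by (auto simp: V_def one)
  have pow: "\<pi> (g [^] m) = ((\<lambda>q. nf_mult q (\<pi> g)) ^^ m) (0, 0)" if "g \<in> carrier G" for g and m :: nat
    using that by (induction m) (simp_all add: one mult)
  have commute: "x \<otimes> y = y \<otimes> x \<longleftrightarrow> cls x = cls y" if xy: "x \<in> V" "y \<in> V" for x y
  proof
    assume "x \<otimes> y = y \<otimes> x"
    then have "nf_mult (\<pi> x) (\<pi> y) = nf_mult (\<pi> y) (\<pi> x)"
      using xy mult[of x y] mult[of y x] by (simp add: V)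
    then show "cls x = cls y"
      using xy nf by (simp add: V cls_def nf_mult_commute_iff)
  next
    assume eq: "cls x = cls y"
    \<comment> \<open>\<open>g\<close> lifts the generator of the common class. Both x and y have
      the image of a power of \<open>g\<close>, so both are central translates of powers of
      \<open>g\<close>.\<close>
    obtain g where g: "g \<in> carrier G" "\<pi> g = class_gen (cls x)"
      using surj[OF class_gen_closed[OF nf_class_less], of "\<pi> x"] by (auto simp: cls_def)
    have "\<exists>m :: nat. u \<in> center G #> (g [^] m)" if u: "u \<in> V" "cls u = cls x" for u
    proof -
      obtain m where "\<pi> u = ((\<lambda>q. nf_mult q (class_gen (cls u))) ^^ m) (0, 0)"
        using nf_power_class_gen[of "\<pi> u"] u nf by (auto simp: V cls_def)
      then have "\<pi> u = \<pi> (g [^] m)" using u g pow by simp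
      then show ?thesis using u g fibre[of "g [^] m"] by (auto simp: V)
    qed
    then show "x \<otimes> y = y \<otimes> x"
      using xy eq g(1) commute_center_translates_of_powers by metis
  qed
  have card_cls: "card {x \<in> V. cls x = c} = (if c = 0 then 4 else 3) * z" if c: "c < 6" for c
  proof -
    let ?P = "{p \<in> nf_set - {(0, 0)}. nf_class p = c}"
    have "{x \<in> V. cls x = c} = (\<Union>p\<in>?P. {x \<in> carrier G. \<pi> x = p})"
      using nf by (auto simp: V cls_def)
    also have "card \<dots> = (\<Sum>p\<in>?P. card {x \<in> carrier G. \<pi> x = p})"
      by (rule card_UN_disjoint) (use assms(1) in \<open>auto simp: nf_set_def\<close>)
    also have "\<dots> = card ?P * z" by (simp add: card_fibre)
    finally show ?thesis by (simp only: card_nf_class[OF c])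
  qed
  show thesis
    using that[of cls] commute card_cls nf_class_less by (simp add: cls_def V_def z_def)
qed

section \<open>The spectrum of the commuting graph\<close>

theorem theorem2p7:
  fixes G :: "('a, 'b) monoid_scheme"
  assumes "group G"
    and "finite (carrier G)"
    and "(G Mod center G) \<cong> Sz2"
  shows "graph_spectrum (commuting_graph G) =
    replicate_mset (19 * card (center G) - 6) (- 1)
    + replicate_mset 1 (4 * of_nat (card (center G)) - 1)
    + replicate_mset 5 (3 * of_nat (card (center G)) - 1)"
proof -
  interpret group G by fact
  interpret normal "center G" G by (rule center_normal)
  define V where "V = carrier G - center G"
  define z where "z = card (center G)"
  obtain cls :: "'a \<Rightarrow> nat" where cls_less: "\<And>x. cls x < 6"
    and commute: "\<And>x y. x \<in> V \<Longrightarrow> y \<in> V \<Longrightarrow> x \<otimes>\<^bsub>G\<^esub> y = y \<otimes>\<^bsub>G\<^esub> x \<longleftrightarrow> cls x = cls y"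
    and card_cls: "\<And>c. c < 6 \<Longrightarrow> card {x \<in> V. cls x = c} = (if c = 0 then 4 else 3) * z"
    using commuting_classes[OF assms(2,3)] unfolding V_def z_def by blast
  have "card V = (\<Sum>c<6. card {x \<in> V. cls x = c})"
  proof -
    have "V = (\<Union>c<6. {x \<in> V. cls x = c})" using cls_less by auto
    then have "card V = card (\<Union>c<6. {x \<in> V. cls x = c})" by simp
    also have "\<dots> = (\<Sum>c<6. card {x \<in> V. cls x = c})"
      by (rule card_UN_disjoint) (use assms(2) in \<open>auto simp: V_def\<close>)
    finally show ?thesis .
  qed
  \<comment> \<open>19 = 4 + 5 * 3 is the number of nontrivial elements of Sz(2).\<close>
  then have card_V: "card V = 19 * z" by (simp add: card_cls eval_nat_numeral)
  obtain vs where vs: "distinct vs" "set vs = V"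
    using finite_distinct_list[of V] assms(2) by (auto simp: V_def)
  have len: "length vs = 19 * z" using distinct_card[OF vs(1)] vs(2) card_V by simp
  let ?p = "char_poly (adjacency_matrix (commuting_graph G) vs)"
  let ?r = "\<lambda>c. 1 - of_nat (card {x \<in> set vs. cls x = c}) :: complex"
  have poly: "[:1, 1:] ^ 6 * ?p = [:1, 1:] ^ length vs * (\<Prod>c<6. [:?r c, 1:])"
  proof (rule char_poly_disjoint_cliques)
    show "cls x < 6" for x by (rule cls_less)
    show "(x, y) \<in> parcs (commuting_graph G) \<longleftrightarrow> x \<noteq> y \<and> cls x = cls y"
      if "x \<in> set vs" "y \<in> set vs" for x y
      using that commute by (auto simp: vs commuting_graph_def simp flip: V_def)
  qed fact
  \<comment> \<open>The right side of \<open>poly\<close> is a product of nonzero linear factors.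
    Nonvanishing is required for \<open>proots_mult\<close>.\<close>
  have "?p \<noteq> 0"
    using poly by (auto simp del: power_Suc)
  have prod: "(\<Prod>c<6. [:?r c, 1:]) = [:1 - 4 * of_nat z, 1:] * [:1 - 3 * of_nat z, 1:] ^ 5"
  proof -
    \<comment> \<open>The translation class gives the single clique of size 4z, the five stabilizers
      those of size 3z.\<close>
    have "{..<6 :: nat} = insert 0 {1..5}" by auto
    then have "(\<Prod>c<6. [:?r c, 1:]) = [:?r 0, 1:] * (\<Prod>c\<in>{1..5}. [:?r c, 1:])"
      by (simp only:) simp
    also have "(\<Prod>c\<in>{1..5}. [:?r c, 1:]) = (\<Prod>c\<in>{1..5 :: nat}. [:1 - 3 * of_nat z, 1:])"
      by (rule prod.cong) (auto simp: vs card_cls)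
    also have "\<dots> = [:1 - 3 * of_nat z, 1:] ^ 5"
      by (simp only: prod_constant card_atLeastAtMost) simp
    finally show ?thesis by (simp only: vs card_cls) simp
  qed
  have "proots ([:1, 1:] ^ 6 * ?p) = proots ([:1, 1:] ^ length vs * (\<Prod>c<6. [:?r c, 1:]))"
    by (simp only: poly)
  moreover have "proots ([:1, 1:] ^ 6 * ?p) = replicate_mset 6 (- 1) + proots ?p"
    using \<open>?p \<noteq> 0\<close> by (subst proots_mult) (simp_all only: proots_power, simp_all)
  moreover have "proots ([:1, 1:] ^ length vs * (\<Prod>c<6. [:?r c, 1:])) =
      proots ([:1, 1:] ^ length vs) + (proots [:1 - 4 * of_nat z, 1:] + proots ([:1 - 3 * of_nat z, 1:] ^ 5))"
    unfolding prod by (simp only: proots_mult mult_eq_0_iff power_eq_0_iff pCons_eq_0_iff one_neq_zero simp_thms not_False_eq_True)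
  ultimately have "replicate_mset 6 (- 1) + proots ?p =
      replicate_mset (19 * z) (- 1) + (replicate_mset 1 (4 * of_nat z - 1) + replicate_mset 5 (3 * of_nat z - 1))"
    by (simp add: proots_power len)
  \<comment> \<open>The centre contains the identity, so 19z is at least 6: the subtraction is not
    truncated, and six copies of -1 can be cancelled.\<close>
  moreover have "z \<noteq> 0"
    using finite_subset[OF subset assms(2)] one_closed
    unfolding z_def card_eq_0_iff by blast
  then have "replicate_mset (19 * z) (- 1 :: complex) = replicate_mset 6 (- 1) + replicate_mset (19 * z - 6) (- 1)"
    by (intro multiset_eqI) simp
  ultimately have "proots ?p = replicate_mset (19 * z - 6) (- 1) +
      replicate_mset 1 (4 * of_nat z - 1) + replicate_mset 5 (3 * of_nat z - 1)"
    by (simp add: add.assoc)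
  moreover have "graph_spectrum (commuting_graph G) = proots ?p"
    by (rule graph_spectrum_eq) (simp_all add: vs commuting_graph_def V_def)
  ultimately show ?thesis by (simp add: z_def)
qed

end
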